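(* Let $J\ge 3$ and $F\in\mathfrak{F}$. The models $(\text{reference},F,\text{complete})$ and $(\text{reference},F,\text{proportional})$ are each invariant under each of the $(J-1)!$ permutations $\sigma$ of $\{1,\dots,J\}$ that fix the reference category (that is, $\sigma(J)=J$).
   Context: Setting. Let $J\ge 3$ (number of categories), $p\ge 1$, and let $\mathcal{X}\subseteq\mathbb{R}^p$ be the nonempty set of values of the explanatory vector $x$. Let $\mathcal{M}=\{\pi\in\,]0,1[^{J-1} : \sum_{j=1}^{J-1}\pi_j<1\}$; for $\pi\in\mathcal{M}$ put $\pi_J=1-\sum_{j=1}^{J-1}\pi_j$ ($\pi_j$ is the probability of category $j$). Ratio. The reference ratio $r:\mathcal{M}\to\,]0,1[^{J-1}$ is $r_j(\pi)=\pi_j/(\pi_j+\pi_J)$, $j=1,\dots,J-1$; it is a bijection onto $]0,1[^{J-1}$. The reference category is $J$. Cdfs. $\mathfrak{F}$ is the set of continuous cumulative distribution functions $F$ on $\mathbb{R}$ that are strictly increasing on the open interval $I_F=\{w: 0<F(w)<1\}$, so that $F$ maps $I_F$ bijectively onto $]0,1[$. Design matrices. "Complete" refers to the $(J-1)\times(J-1)(1+p)$ matrix $Z_c(x)$ with $Z_c(x)\beta=(\alpha_j+x^t\delta_j)_{j=1,\dots,J-1}$ for $\beta=(\alpha_1,\dots,\alpha_{J-1},\delta_1^t,\dots,\delta_{J-1}^t)^t$, $\alpha_j\in\mathbb{R}$, $\delta_j\in\mathbb{R}^p$. "Proportional" refers to the $(J-1)\times(J-1+p)$ matrix $Z_p(x)$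 with $Z_p(x)\beta=(\alpha_j+x^t\delta)_{j=1,\dots,J-1}$ for $\beta=(\alpha_1,\dots,\alpha_{J-1},\delta^t)^t$, $\delta\in\mathbb{R}^p$. Models. A model $(r,F,Z)$, with $Z$ having $q$ columns, has as parameter space the set of $\beta\in\mathbb{R}^q$ such that for all $x\in\mathcal{X}$, $\eta=Z(x)\beta$ satisfies $\eta\in I_F^{J-1}$ and $(F(\eta_1),\dots,F(\eta_{J-1}))\in r(\mathcal{M})$. For such $\beta$ and $x\in\mathcal{X}$, it defines the unique $\pi=\pi(x;\beta)\in\mathcal{M}$ with $r(\pi)=(F(\eta_1),\dots,F(\eta_{J-1}))^t$, $\eta=Z(x)\beta$. Permuted models. For a permutation $\sigma$ of $\{1,\dots,J\}$ and $\pi\in\mathcal{M}$, let $\pi_\sigma=(\pi_{\sigma(1)},\dots,\pi_{\sigma(J-1)})\in\mathcal{M}$. The permuted model $(r,F,Z)_\sigma$ has the same parameter space as $(r,F,Z)$ and defines $\pi=\pi(x;\beta)\in\mathcal{M}$ by $r(\pi_\sigma)=(F(\eta_1),\dots,F(\eta_{J-1}))^t$, $\eta=Z(x)\beta$. Equivalence and invariance. Two (possibly permuted) models, giving $\pi(x;\beta)$ and $\pi'(x;\beta')$, are equivalent if there is a bijection $h$ from the parameter space of the first to that of the second such that $\pi(x;\beta)=\pi'(x;h(\beta))$ for all $x\in\mathcal{X}$ and all $\beta$ in the first parameter space. A model $(r,F,Z)$ is invariant under $\sigma$ if $(r,F,Z)$ and $(r,F,Z)_\sigma$ are equivalent. 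*)

theory Defs
  imports
    "HOL-Probability.Distribution_Functions"
    "HOL-Combinatorics.Permutations"
    "Jordan_Normal_Form.Matrix"
begin

hide_type (open) Finite_Cartesian_Product.vec
hide_const (open) Finite_Cartesian_Product.vec Finite_Cartesian_Product.mat
unbundle no vec_syntax

text \<open>
  Categories are numbered 1, ..., J with reference category J. A vector in R^(J-1) is a
  \<^typ>\<open>real vec\<close> of dimension J - 1, whose entries are indexed from 0, so the entry
  belonging to category j < J has index j - 1.
\<close>

definition prob_vectors :: "nat \<Rightarrow> real vec set" where
  "prob_vectors J = {\<pi> \<in> carrier_vec (J - 1).
     (\<forall>i<J - 1. 0 < \<pi> $ i \<and> \<pi> $ i < 1) \<and> (\<Sum>i<J - 1. \<pi> $ i) < 1}"

definition category_prob :: "nat \<Rightarrow> real vec \<Rightarrow> nat \<Rightarrow> real" where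
  "category_prob J \<pi> j = (if j < J then \<pi> $ (j - 1) else 1 - (\<Sum>i<J - 1. \<pi> $ i))"

definition reference_ratio :: "nat \<Rightarrow> real vec \<Rightarrow> real vec" where
  "reference_ratio J \<pi> = vec (J - 1)
     (\<lambda>i. category_prob J \<pi> (i + 1) / (category_prob J \<pi> (i + 1) + category_prob J \<pi> J))"

definition permute_probs :: "nat \<Rightarrow> (nat \<Rightarrow> nat) \<Rightarrow> real vec \<Rightarrow> real vec" where
  "permute_probs J \<sigma> \<pi> = vec (J - 1) (\<lambda>i. category_prob J \<pi> (\<sigma> (i + 1)))"

definition cdf_support :: "(real \<Rightarrow> real) \<Rightarrow> real set" where
  "cdf_support F = {w. 0 < F w \<and> F w < 1}"

definition admissible_cdfs :: "(real \<Rightarrow> real) set" where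
  "admissible_cdfs = {F. (\<exists>M. real_distribution M \<and> F = cdf M) \<and>
     continuous_on UNIV F \<and> strict_mono_on (cdf_support F) F}"

text \<open>
  Column layout: the J - 1 intercepts come first, then the slopes; in the complete design the
  slopes form J - 1 consecutive blocks of length p.
\<close>

definition complete_design :: "nat \<Rightarrow> nat \<Rightarrow> real vec \<Rightarrow> real mat" where
  "complete_design J p x = mat (J - 1) ((J - 1) * (1 + p))
     (\<lambda>(i, k). if k < J - 1 then (if k = i then 1 else 0)
               else if (k - (J - 1)) div p = i then x $ ((k - (J - 1)) mod p) else 0)"

definition proportional_design :: "nat \<Rightarrow> nat \<Rightarrow> real vec \<Rightarrow> real mat" where
  "proportional_design J p x = mat (J - 1) (J - 1 + p)
     (\<lambda>(i, k). if k < J - 1 then (if k = i then 1 else 0) else x $ (k - (J - 1)))"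

lemma complete_design_mult:
  assumes "x \<in> carrier_vec p" "\<beta> \<in> carrier_vec ((J - 1) * (1 + p))" "i < J - 1"
  shows "(complete_design J p x *\<^sub>v \<beta>) $ i =
    \<beta> $ i + x \<bullet> vec p (\<lambda>l. \<beta> $ (J - 1 + i * p + l))"
proof -
  define n where "n = J - 1"
  have i: "i < n" using assms by (simp add: n_def)
  define g where "g k = (if k < n then (if k = i then 1 else 0)
    else if (k - n) div p = i then x $ ((k - n) mod p) else 0) * \<beta> $ k" for k
  have "(complete_design J p x *\<^sub>v \<beta>) $ i = (\<Sum>k<n + n * p. g k)"
    using assms(2) i
    by (auto simp: complete_design_def scalar_prod_def g_def n_def atLeast0LessThan
        intro!: sum.cong)
  also have "\<dots> = (\<Sum>k<n. g k) + (\<Sum>k<n * p. g (n + k))"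
    using sum.atLeastLessThan_concat[of 0 n "n + n * p" g]
      sum.shift_bounds_nat_ivl[of g 0 n "n * p"]
    by (simp add: atLeast0LessThan add.commute)
  also have "(\<Sum>k<n. g k) = (\<Sum>k<n. if k = i then \<beta> $ k else 0)"
    by (intro sum.cong) (auto simp: g_def)
  also have "\<dots> = \<beta> $ i"
    using i by simp
  also have "(\<Sum>k<n * p. g (n + k)) = (\<Sum>m<n. \<Sum>k\<in>{m * p..<m * p + p}. g (n + k))"
    using sum.nat_group[of "\<lambda>k. g (n + k)" p n] by simp
  also have "\<dots> = (\<Sum>m<n. \<Sum>l<p. g (n + m * p + l))"
  proof (rule sum.cong[OF refl])
    fix m
    show "(\<Sum>k\<in>{m * p..<m * p + p}. g (n + k)) = (\<Sum>l<p. g (n + m * p + l))"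
      using sum.shift_bounds_nat_ivl[of "\<lambda>k. g (n + k)" 0 "m * p" p]
      by (simp add: atLeast0LessThan ac_simps)
  qed
  also have "\<dots> = (\<Sum>m<n. if m = i then \<Sum>l<p. x $ l * \<beta> $ (n + m * p + l) else 0)"
    by (rule sum.cong[OF refl]) (auto simp: g_def add.assoc intro!: sum.cong sum.neutral)
  also have "\<dots> = x \<bullet> vec p (\<lambda>l. \<beta> $ (n + i * p + l))"
    using i by (simp add: scalar_prod_def atLeast0LessThan)
  finally show ?thesis by (simp add: n_def)
qed

lemma proportional_design_mult:
  assumes "x \<in> carrier_vec p" "\<beta> \<in> carrier_vec (J - 1 + p)" "i < J - 1"
  shows "(proportional_design J p x *\<^sub>v \<beta>) $ i =
    \<beta> $ i + x \<bullet> vec p (\<lambda>l. \<beta> $ (J - 1 + l))"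
proof -
  define n where "n = J - 1"
  have i: "i < n" using assms by (simp add: n_def)
  define g where "g k = (if k < n then (if k = i then 1 else 0) else x $ (k - n)) * \<beta> $ k" for k
  have "(proportional_design J p x *\<^sub>v \<beta>) $ i = (\<Sum>k<n + p. g k)"
    using assms(2) i
    by (auto simp: proportional_design_def scalar_prod_def g_def n_def atLeast0LessThan
        intro!: sum.cong)
  also have "\<dots> = (\<Sum>k<n. g k) + (\<Sum>k<p. g (n + k))"
    using sum.atLeastLessThan_concat[of 0 n "n + p" g]
      sum.shift_bounds_nat_ivl[of g 0 n p]
    by (simp add: atLeast0LessThan add.commute)
  also have "(\<Sum>k<n. g k) = (\<Sum>k<n. if k = i then \<beta> $ k else 0)"
    by (intro sum.cong) (auto simp: g_def)
  also have "\<dots> = \<beta> $ i"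
    using i by simp
  also have "(\<Sum>k<p. g (n + k)) = x \<bullet> vec p (\<lambda>l. \<beta> $ (n + l))"
    by (simp add: scalar_prod_def g_def atLeast0LessThan)
  finally show ?thesis by (simp add: n_def)
qed

text \<open>
  In the following, a model (r, F, Z) is given by its components, where \<open>q\<close> is the number of
  columns of the design matrices \<open>Z x\<close>.
\<close>

definition parameter_space ::
  "nat \<Rightarrow> real vec set \<Rightarrow> (real vec \<Rightarrow> real vec) \<Rightarrow> (real \<Rightarrow> real) \<Rightarrow>
    (real vec \<Rightarrow> real mat) \<Rightarrow> nat \<Rightarrow> real vec set" where
  "parameter_space J X r F Z q = {\<beta> \<in> carrier_vec q. \<forall>x\<in>X.
     (\<forall>i<J - 1. (Z x *\<^sub>v \<beta>) $ i \<in> cdf_support F) \<and>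
     map_vec F (Z x *\<^sub>v \<beta>) \<in> r ` prob_vectors J}"

definition model_probs ::
  "nat \<Rightarrow> (real vec \<Rightarrow> real vec) \<Rightarrow> (real \<Rightarrow> real) \<Rightarrow> (real vec \<Rightarrow> real mat) \<Rightarrow>
    real vec \<Rightarrow> real vec \<Rightarrow> real vec" where
  "model_probs J r F Z x \<beta> =
     (THE \<pi>. \<pi> \<in> prob_vectors J \<and> r \<pi> = map_vec F (Z x *\<^sub>v \<beta>))"

definition permuted_model_probs ::
  "nat \<Rightarrow> (real vec \<Rightarrow> real vec) \<Rightarrow> (real \<Rightarrow> real) \<Rightarrow> (real vec \<Rightarrow> real mat) \<Rightarrow>
    (nat \<Rightarrow> nat) \<Rightarrow> real vec \<Rightarrow> real vec \<Rightarrow> real vec" where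
  "permuted_model_probs J r F Z \<sigma> x \<beta> =
     (THE \<pi>. \<pi> \<in> prob_vectors J \<and> r (permute_probs J \<sigma> \<pi>) = map_vec F (Z x *\<^sub>v \<beta>))"

text \<open>
  Here a (possibly permuted) model enters only through its parameter space \<open>B\<close> and the map \<open>P\<close>
  sending a value of the explanatory vector and a parameter to the category probabilities.
\<close>

definition equivalent_models ::
  "real vec set \<Rightarrow> real vec set \<times> (real vec \<Rightarrow> real vec \<Rightarrow> real vec) \<Rightarrow>
    real vec set \<times> (real vec \<Rightarrow> real vec \<Rightarrow> real vec) \<Rightarrow> bool" where
  "equivalent_models X = (\<lambda>(B, P) (B', P').
     \<exists>h. bij_betw h B B' \<and> (\<forall>x\<in>X. \<forall>\<beta>\<in>B. P x \<beta> = P' x (h \<beta>)))"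

definition invariant_model ::
  "nat \<Rightarrow> real vec set \<Rightarrow> (real vec \<Rightarrow> real vec) \<Rightarrow> (real \<Rightarrow> real) \<Rightarrow>
    (real vec \<Rightarrow> real mat) \<Rightarrow> nat \<Rightarrow> (nat \<Rightarrow> nat) \<Rightarrow> bool" where
  "invariant_model J X r F Z q \<sigma> \<longleftrightarrow>
     equivalent_models X
       (parameter_space J X r F Z q, model_probs J r F Z)
       (parameter_space J X r F Z q, permuted_model_probs J r F Z \<sigma>)"

end

theory Submission
  imports Defs
begin

text \<open>
  When \<open>\<sigma>\<close> fixes the reference category, permuting the probabilities merely permutes the entries of
  the reference ratio, so it suffices to permute the entries of the linear predictor
  accordingly. Permuting the intercepts (and, for the complete design, the blocks of slopes) of
  the parameter vector does this for all \<open>x\<close> at once.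
\<close>

text \<open>Keeps \<open>J - 1\<close>, \<open>i + 1\<close> and \<open>1 + p\<close> from being
  rewritten to terms in \<open>Suc 0\<close>, so that they keep matching the lemmas below.\<close>

declare One_nat_def [simp del]

section \<open>Rearranging the entries of a vector\<close>

definition reindex_vec :: "nat \<Rightarrow> (nat \<Rightarrow> nat) \<Rightarrow> 'a vec \<Rightarrow> 'a vec" where
  "reindex_vec n s v = vec n (\<lambda>i. v $ s i)"

lemma reindex_vec_carrier [simp]: "reindex_vec n s v \<in> carrier_vec n"
  by (simp add: reindex_vec_def)

lemma index_reindex_vec [simp]: "i < n \<Longrightarrow> reindex_vec n s v $ i = v $ s i"
  by (simp add: reindex_vec_def)

text \<open>Rearrangements compose in reverse order: the left side reads \<open>v\<close> at
  \<open>s (s' i)\<close>. Inverses on the indices below \<open>n\<close> suffice, which is the form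
  in which \<open>block_perm\<close> supplies them.\<close>

lemma reindex_vec_cancel:
  assumes "v \<in> carrier_vec n" "\<And>i. i < n \<Longrightarrow> s' i < n" "\<And>i. i < n \<Longrightarrow> s (s' i) = i"
  shows "reindex_vec n s' (reindex_vec n s v) = v"
  using assms by (intro eq_vecI) (auto simp: reindex_vec_def)

lemma permutes_less_iff:
  fixes s :: "nat \<Rightarrow> nat"
  assumes "s permutes {..<n}"
  shows "s i < n \<longleftrightarrow> i < n"
  using permutes_in_image[OF assms, of i] by simp

lemma reindex_vec_inv [simp]:
  assumes s: "s permutes {..<n}" and v: "v \<in> carrier_vec n"
  shows "reindex_vec n (inv_into UNIV s) (reindex_vec n s v) = v"
    and "reindex_vec n s (reindex_vec n (inv_into UNIV s) v) = v"
  using permutes_less_iff[OF s] permutes_less_iff[OF permutes_inv[OF s]] permutes_inverses[OF s]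
  by (auto intro!: reindex_vec_cancel[OF v])

lemma reindex_vec_eq_iff:
  assumes "s permutes {..<n}" "v \<in> carrier_vec n" "w \<in> carrier_vec n"
  shows "reindex_vec n s v = reindex_vec n s w \<longleftrightarrow> v = w"
  using reindex_vec_inv(1) assms by metis

lemma map_vec_reindex_vec:
  assumes "s permutes {..<n}" "v \<in> carrier_vec n"
  shows "map_vec f (reindex_vec n s v) = reindex_vec n s (map_vec f v)"
  using assms by (intro eq_vecI) (auto simp: reindex_vec_def permutes_less_iff)

section \<open>Action on probability vectors and on the reference ratio\<close>

lemma reindex_vec_prob_vectors:
  assumes s: "s permutes {..<J - 1}" and \<pi>: "\<pi> \<in> prob_vectors J"
  shows "reindex_vec (J - 1) s \<pi> \<in> prob_vectors J"
proof -
  have "(\<Sum>i<J - 1. reindex_vec (J - 1) s \<pi> $ i) = (\<Sum>i<J - 1. \<pi> $ i)"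
    using sum.permute[OF s, of "\<lambda>i. \<pi> $ i"] by (simp add: o_def)
  then show ?thesis
    using \<pi> by (simp add: prob_vectors_def permutes_less_iff[OF s])
qed

lemma reference_ratio_carrier [simp]: "reference_ratio J \<pi> \<in> carrier_vec (J - 1)"
  by (simp add: reference_ratio_def)

text \<open>Each entry of the ratio involves only its own category and \<open>J\<close>. The
  probability of \<open>J\<close> is one minus the sum of all entries, so a rearrangement leaves it
  unchanged.\<close>

lemma reference_ratio_reindex_vec:
  assumes s: "s permutes {..<J - 1}"
  shows "reference_ratio J (reindex_vec (J - 1) s \<pi>) = reindex_vec (J - 1) s (reference_ratio J \<pi>)"
proof -
  have "(\<Sum>i<J - 1. reindex_vec (J - 1) s \<pi> $ i) = (\<Sum>i<J - 1. \<pi> $ i)"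
    using sum.permute[OF s, of "\<lambda>i. \<pi> $ i"] by (simp add: o_def)
  then have "category_prob J (reindex_vec (J - 1) s \<pi>) J = category_prob J \<pi> J"
    by (simp add: category_prob_def)
  moreover have "category_prob J v (i + 1) = v $ i" if "i < J - 1" for v i
    using that by (simp add: category_prob_def)
  ultimately show ?thesis
    by (intro eq_vecI) (simp_all add: reference_ratio_def reindex_vec_def permutes_less_iff[OF s])
qed

text \<open>The image is closed under every permutation of the entries; applying this to
  \<open>s\<close> and to its inverse gives both directions. It transfers the ratio condition in
  \<open>parameter_space\<close>.\<close>

lemma reindex_vec_in_ratio_image_iff:
  assumes s: "s permutes {..<J - 1}" and v: "v \<in> carrier_vec (J - 1)"
  shows "reindex_vec (J - 1) s v \<in> reference_ratio J ` prob_vectors J \<longleftrightarrow>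
    v \<in> reference_ratio J ` prob_vectors J"
proof -
  have closed: "reindex_vec (J - 1) t w \<in> reference_ratio J ` prob_vectors J"
    if "t permutes {..<J - 1}" "w \<in> reference_ratio J ` prob_vectors J" for t w
  proof -
    obtain \<pi> where \<pi>: "\<pi> \<in> prob_vectors J" "w = reference_ratio J \<pi>"
      using \<open>w \<in> _\<close> by blast
    then show ?thesis
      using reindex_vec_prob_vectors[OF \<open>t permutes _\<close>]
      by (auto simp: reference_ratio_reindex_vec[OF \<open>t permutes _\<close>, symmetric])
  qed
  show ?thesis
    using closed[OF s, of v] closed[OF permutes_inv[OF s], of "reindex_vec (J - 1) s v"] s v
    by auto
qed

section \<open>From permutations of categories to permutations of indices\<close>

text \<open>Categories are numbered from 1, vector entries from 0.\<close>

definition index_perm :: "(nat \<Rightarrow> nat) \<Rightarrow> nat \<Rightarrow> nat" where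
  "index_perm \<sigma> i = \<sigma> (i + 1) - 1"

lemma fixing_last_permutes_iff:
  fixes J :: nat
  assumes "J \<ge> 1"
  shows "\<sigma> permutes {1..J} \<and> \<sigma> J = J \<longleftrightarrow> \<sigma> permutes {1..J - 1}"
proof -
  have "{1..J} = insert J {1..J - 1}" using assms by auto
  then show ?thesis
    using assms by (auto simp: permutes_not_in intro: permutes_superset permutes_subset)
qed

text \<open>\<open>index_perm\<close> is the conjugate of \<open>\<sigma>\<close> by the shift
  \<open>i + 1\<close>, a bijection from \<open>{..<n}\<close> onto \<open>{1..n}\<close>.\<close>

lemma index_perm_permutes:
  assumes "\<sigma> permutes {1..n}"
  shows "index_perm \<sigma> permutes {..<n}"
proof (rule bij_imp_permutes)
  have "bij_betw (\<lambda>i. i + 1) {..<n} {1..n}"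
    by (rule bij_betw_byWitness[of _ "\<lambda>i. i - 1"]) auto
  moreover have "bij_betw (\<lambda>i. i - 1) {1..n} {..<n}"
    by (rule bij_betw_byWitness[of _ "\<lambda>i. i + 1"]) auto
  ultimately have "bij_betw ((\<lambda>i. i - 1) \<circ> (\<sigma> \<circ> (\<lambda>i. i + 1))) {..<n} {..<n}"
    using permutes_imp_bij[OF assms] by (blast intro: bij_betw_trans)
  then show "bij_betw (index_perm \<sigma>) {..<n} {..<n}"
    by (simp add: index_perm_def[abs_def] o_def)
  show "index_perm \<sigma> i = i" if "i \<notin> {..<n}" for i
    using that permutes_not_in[OF assms, of "i + 1"] by (simp add: index_perm_def)
qed

text \<open>As \<open>\<sigma>\<close> maps \<open>{1..J - 1}\<close> into itself,
  \<open>category_prob\<close> is evaluated only at categories below \<open>J\<close>, where it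
  reads an entry of \<open>\<pi>\<close>.\<close>

lemma permute_probs_eq_reindex_vec:
  assumes "\<sigma> permutes {1..J - 1}"
  shows "permute_probs J \<sigma> \<pi> = reindex_vec (J - 1) (index_perm \<sigma>) \<pi>"
proof (intro eq_vecI)
  fix i assume "i < dim_vec (reindex_vec (J - 1) (index_perm \<sigma>) \<pi>)"
  then have i: "i < J - 1" by (simp add: reindex_vec_def)
  then have "\<sigma> (i + 1) \<in> {1..J - 1}"
    using permutes_in_image[OF assms, of "i + 1"] by simp
  then show "permute_probs J \<sigma> \<pi> $ i = reindex_vec (J - 1) (index_perm \<sigma>) \<pi> $ i"
    using i by (auto simp: permute_probs_def category_prob_def index_perm_def)
qed (simp add: permute_probs_def reindex_vec_def)

section \<open>Invariance from a rearrangement of the parameters\<close>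

text \<open>Isolates what a design must provide: a rearrangement \<open>\<tau>\<close> of the
  parameter coordinates that permutes the linear predictor by \<open>index_perm \<sigma>\<close>,
  for every \<open>x\<close> alike. Then \<open>reindex_vec q \<tau>\<close> is the bijection
  required for equivalence.\<close>

lemma invariant_model_if_column_rearrangement:
  assumes \<sigma>: "\<sigma> permutes {1..J - 1}"
    and Z: "\<And>x. x \<in> X \<Longrightarrow> Z x \<in> carrier_mat (J - 1) q"
    and \<tau>: "\<And>k. k < q \<Longrightarrow> \<tau> k < q" "\<And>k. k < q \<Longrightarrow> \<tau>' (\<tau> k) = k"
    and \<tau>': "\<And>k. k < q \<Longrightarrow> \<tau>' k < q" "\<And>k. k < q \<Longrightarrow> \<tau> (\<tau>' k) = k"
    and eta: "\<And>x \<beta> i. x \<in> X \<Longrightarrow> \<beta> \<in> carrier_vec q \<Longrightarrow> i < J - 1 \<Longrightarrow>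
      (Z x *\<^sub>v reindex_vec q \<tau> \<beta>) $ i = (Z x *\<^sub>v \<beta>) $ index_perm \<sigma> i"
  shows "invariant_model J X (reference_ratio J) F Z q \<sigma>"
proof -
  let ?s = "index_perm \<sigma>" and ?h = "reindex_vec q \<tau>" and ?h' = "reindex_vec q \<tau>'"
  let ?B = "parameter_space J X (reference_ratio J) F Z q"
  have s: "?s permutes {..<J - 1}"
    by (rule index_perm_permutes[OF \<sigma>])
  have pred: "Z x *\<^sub>v ?h \<beta> = reindex_vec (J - 1) ?s (Z x *\<^sub>v \<beta>)"
    if "x \<in> X" "\<beta> \<in> carrier_vec q" for x \<beta>
    using that Z[of x] eta[of x \<beta>] by (intro eq_vecI) (auto simp: reindex_vec_def)
  have carrier: "Z x *\<^sub>v \<beta> \<in> carrier_vec (J - 1)" if "x \<in> X" for x \<beta>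
    using Z[OF that] by (intro carrier_vecI) simp
  have mapF: "map_vec F (Z x *\<^sub>v ?h \<beta>) = reindex_vec (J - 1) ?s (map_vec F (Z x *\<^sub>v \<beta>))"
    if "x \<in> X" "\<beta> \<in> carrier_vec q" for x \<beta>
    using that by (simp add: pred map_vec_reindex_vec[OF s carrier])
  have support: "(\<forall>i<J - 1. (Z x *\<^sub>v ?h \<beta>) $ i \<in> cdf_support F) \<longleftrightarrow>
      (\<forall>i<J - 1. (Z x *\<^sub>v \<beta>) $ i \<in> cdf_support F)"
    if "x \<in> X" "\<beta> \<in> carrier_vec q" for x \<beta>
  proof -
    have "(\<forall>i<J - 1. (Z x *\<^sub>v ?h \<beta>) $ i \<in> cdf_support F) \<longleftrightarrow>
        (\<forall>i\<in>{..<J - 1}. (Z x *\<^sub>v \<beta>) $ ?s i \<in> cdf_support F)"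
      using that by (auto simp: eta)
    \<comment> \<open>The support condition is the same for every entry, and \<open>?s\<close> maps
      the index set onto itself.\<close>
    also have "\<dots> \<longleftrightarrow> (\<forall>i\<in>?s ` {..<J - 1}. (Z x *\<^sub>v \<beta>) $ i \<in> cdf_support F)"
      by blast
    finally show ?thesis
      by (auto simp: permutes_image[OF s])
  qed
  have B_iff: "?h \<beta> \<in> ?B \<longleftrightarrow> \<beta> \<in> ?B" if "\<beta> \<in> carrier_vec q" for \<beta>
    using that
    by (auto simp: parameter_space_def support mapF
        reindex_vec_in_ratio_image_iff[OF s] carrier)
  have bij: "bij_betw ?h ?B ?B"
  proof (rule bij_betw_byWitness[of _ ?h'])
    have cancel: "?h (?h' \<beta>) = \<beta>" "?h' (?h \<beta>) = \<beta>" if "\<beta> \<in> carrier_vec q" for \<beta>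
      using that \<tau> \<tau>' by (auto intro!: reindex_vec_cancel)
    have B: "?B \<subseteq> carrier_vec q"
      by (auto simp: parameter_space_def)
    show "\<forall>\<beta>\<in>?B. ?h' (?h \<beta>) = \<beta>" "\<forall>\<beta>\<in>?B. ?h (?h' \<beta>) = \<beta>"
      using B cancel by auto
    show "?h ` ?B \<subseteq> ?B"
      using B B_iff by auto
    show "?h' ` ?B \<subseteq> ?B"
    proof
      fix \<beta> assume "\<beta> \<in> ?h' ` ?B"
      then obtain \<gamma> where "\<gamma> \<in> ?B" "\<beta> = ?h' \<gamma>" by blast
      then show "\<beta> \<in> ?B"
        \<comment> \<open>\<open>B_iff\<close> reduces membership of \<open>?h' \<gamma>\<close> to
          that of \<open>?h (?h' \<gamma>)\<close>, which is \<open>\<gamma>\<close>.\<close>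
        using B B_iff[of "?h' \<gamma>"] cancel(1)[of \<gamma>] by auto
    qed
  qed
  have "model_probs J (reference_ratio J) F Z x \<beta> =
      permuted_model_probs J (reference_ratio J) F Z \<sigma> x (?h \<beta>)"
    if "x \<in> X" "\<beta> \<in> ?B" for x \<beta>
  proof -
    have "\<beta> \<in> carrier_vec q"
      using that by (simp add: parameter_space_def)
    \<comment> \<open>Both sides of the permuted equation are rearranged by \<open>?s\<close>, which
      cancels by injectivity. The two definite descriptions thus have the same defining predicate
      and denote the same vector.\<close>
    then have "reference_ratio J (permute_probs J \<sigma> \<pi>) = map_vec F (Z x *\<^sub>v ?h \<beta>) \<longleftrightarrow>
        reference_ratio J \<pi> = map_vec F (Z x *\<^sub>v \<beta>)" for \<pi>
      using that(1) carrier[OF that(1)]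
      by (simp add: permute_probs_eq_reindex_vec[OF \<sigma>] reference_ratio_reindex_vec[OF s] mapF
          reindex_vec_eq_iff[OF s])
    then show ?thesis
      by (simp add: model_probs_def permuted_model_probs_def)
  qed
  then show ?thesis
    using bij unfolding invariant_model_def equivalent_models_def by auto
qed

section \<open>The proportional design\<close>

text \<open>All categories share one slope, so only the intercepts have to move.
  \<open>index_perm \<sigma>\<close> itself serves as \<open>\<tau>\<close>, because it fixes every
  index from \<open>J - 1\<close> on, where the slope is stored.\<close>

lemma proportional_invariant:
  assumes X: "X \<subseteq> carrier_vec p" and \<sigma>: "\<sigma> permutes {1..J - 1}"
  shows "invariant_model J X (reference_ratio J) F (proportional_design J p) (J - 1 + p) \<sigma>"
proof -
  let ?n = "J - 1" and ?s = "index_perm \<sigma>"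
  have s: "?s permutes {..<J - 1}"
    by (rule index_perm_permutes[OF \<sigma>])
  note less = permutes_less_iff[OF s] permutes_less_iff[OF permutes_inv[OF s]]
  have s_fix: "?s k = k" "inv_into UNIV ?s k = k" if "\<not> k < J - 1" for k
    using that permutes_not_in[OF s] permutes_not_in[OF permutes_inv[OF s]] by auto
  show ?thesis
  proof (rule invariant_model_if_column_rearrangement[OF \<sigma>, where \<tau> = ?s and \<tau>' = "inv_into UNIV ?s"])
    show "?s k < J - 1 + p" "inv_into UNIV ?s k < J - 1 + p" if "k < J - 1 + p" for k
      using that less[of k] s_fix[of k] by (metis trans_less_add1)+
    fix x \<beta> :: "real vec" and i
    assume "x \<in> X" and \<beta>: "\<beta> \<in> carrier_vec (?n + p)" and i: "i < ?n"
    then have x: "x \<in> carrier_vec p" using X by auto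
    have intercept: "reindex_vec (?n + p) ?s \<beta> $ i = \<beta> $ ?s i"
      using i by simp
    have slope: "vec p (\<lambda>l. reindex_vec (?n + p) ?s \<beta> $ (?n + l)) = vec p (\<lambda>l. \<beta> $ (?n + l))"
      by (intro eq_vecI) (simp_all add: s_fix)
    have si: "?s i < ?n"
      using i by (simp add: less)
    show "(proportional_design J p x *\<^sub>v reindex_vec (?n + p) ?s \<beta>) $ i =
        (proportional_design J p x *\<^sub>v \<beta>) $ ?s i"
      by (simp only: proportional_design_mult[OF x reindex_vec_carrier i]
          proportional_design_mult[OF x \<beta> si] intercept slope)
  qed (simp_all add: permutes_inverses[OF s] proportional_design_def)
qed

section \<open>The complete design\<close>

text \<open>Acts by \<open>s\<close> on the intercepts and on the numbers of the blocks of slopes.\<close>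

definition block_perm :: "nat \<Rightarrow> nat \<Rightarrow> (nat \<Rightarrow> nat) \<Rightarrow> nat \<Rightarrow> nat" where
  "block_perm n p s k =
    (if k < n then s k else n + s ((k - n) div p) * p + (k - n) mod p)"

lemma block_perm_slope:
  assumes "l < p"
  shows "block_perm n p s (n + m * p + l) = n + s m * p + l"
  using assms by (simp add: block_perm_def add.assoc)

lemma block_index_less:
  fixes l m n p :: nat
  assumes "m < n" "l < p"
  shows "n + m * p + l < n * (1 + p)"
proof -
  have "m * p + l < (m + 1) * p" using assms by (simp add: distrib_right)
  also have "\<dots> \<le> n * p" using assms by (intro mult_right_mono) auto
  finally show ?thesis by (simp add: distrib_left)
qed

text \<open>Decodes a column number by division with remainder: either an intercept, or offset
  \<open>l\<close> in the slope block numbered \<open>m\<close>.\<close>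

lemma block_index_cases:
  fixes n p k :: nat
  assumes "k < n * (1 + p)"
  obtains "k < n" | m l where "m < n" "l < p" "k = n + m * p + l"
proof (cases "k < n")
  case False
  have "k - n < n * p" using assms False by (simp add: distrib_left)
  then have "(k - n) div p < n" "(k - n) mod p < p"
    \<comment> \<open>Positivity of \<open>p\<close> follows from \<open>k - n < n * p\<close>, so
      the remainder is a proper offset.\<close>
    by (auto simp: less_mult_imp_div_less intro!: mod_less_divisor Nat.gr0I)
  moreover have "k = n + (k - n) div p * p + (k - n) mod p"
    using False by (simp add: add.assoc)
  ultimately show ?thesis using that(2) by blast
qed (use that in blast)

lemma block_perm_less:
  assumes s: "s permutes {..<n}" and k: "k < n * (1 + p)"
  shows "block_perm n p s k < n * (1 + p)"
  using k
proof (cases rule: block_index_cases)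
  case 1
  then have "s k < n" by (simp add: permutes_less_iff[OF s])
  then show ?thesis using 1 by (simp add: block_perm_def distrib_left)
next
  case (2 m l)
  then show ?thesis
    using block_index_less[of "s m" n l p] by (simp add: block_perm_slope permutes_less_iff[OF s])
qed

lemma block_perm_cancel:
  assumes s: "s permutes {..<n}" and inverse: "\<And>i. s' (s i) = i" and k: "k < n * (1 + p)"
  shows "block_perm n p s' (block_perm n p s k) = k"
  using k
proof (cases rule: block_index_cases)
  case 1
  then show ?thesis by (simp add: block_perm_def permutes_less_iff[OF s] inverse)
next
  case (2 m l)
  then show ?thesis by (simp add: block_perm_slope inverse)
qed

text \<open>Each category has its own intercept and slope block. \<open>block_perm\<close> moves the
  two together, so entry \<open>i\<close> of the new predictor is built from exactly the parameters
  of entry \<open>?s i\<close> of the old one.\<close>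

lemma complete_invariant:
  assumes X: "X \<subseteq> carrier_vec p" and \<sigma>: "\<sigma> permutes {1..J - 1}"
  shows "invariant_model J X (reference_ratio J) F (complete_design J p) ((J - 1) * (1 + p)) \<sigma>"
proof -
  let ?n = "J - 1" and ?s = "index_perm \<sigma>"
  let ?\<tau> = "block_perm ?n p ?s" and ?\<tau>' = "block_perm ?n p (inv_into UNIV ?s)"
  have s: "?s permutes {..<?n}"
    by (rule index_perm_permutes[OF \<sigma>])
  note s' = permutes_inv[OF s]
  show ?thesis
  proof (rule invariant_model_if_column_rearrangement[OF \<sigma>, where \<tau> = ?\<tau> and \<tau>' = ?\<tau>'])
    fix x \<beta> :: "real vec" and i
    assume "x \<in> X" and \<beta>: "\<beta> \<in> carrier_vec (?n * (1 + p))" and i: "i < ?n"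
    then have x: "x \<in> carrier_vec p" using X by auto
    have intercept: "reindex_vec (?n * (1 + p)) ?\<tau> \<beta> $ i = \<beta> $ ?s i"
      using i by (simp add: block_perm_def distrib_left)
    have slopes: "reindex_vec (?n * (1 + p)) ?\<tau> \<beta> $ (?n + i * p + l) = \<beta> $ (?n + ?s i * p + l)"
      if "l < p" for l
      by (simp only: index_reindex_vec[OF block_index_less[OF i that]] block_perm_slope[OF that])
    have slope: "vec p (\<lambda>l. reindex_vec (?n * (1 + p)) ?\<tau> \<beta> $ (?n + i * p + l)) =
        vec p (\<lambda>l. \<beta> $ (?n + ?s i * p + l))"
      by (intro eq_vecI) (simp_all only: dim_vec index_vec slopes)
    have si: "?s i < ?n"
      using i by (simp add: permutes_less_iff[OF s])
    show "(complete_design J p x *\<^sub>v reindex_vec (?n * (1 + p)) ?\<tau> \<beta>) $ i =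
        (complete_design J p x *\<^sub>v \<beta>) $ ?s i"
      by (simp only: complete_design_mult[OF x reindex_vec_carrier i]
          complete_design_mult[OF x \<beta> si] intercept slope)
  qed (auto simp only: block_perm_less[OF s] block_perm_less[OF s'] block_perm_cancel[OF s]
      block_perm_cancel[OF s'] permutes_inverses[OF s] complete_design_def mat_carrier)
qed

theorem corollary4:
  fixes J p :: nat and X :: "real vec set" and F :: "real \<Rightarrow> real"
  assumes "J \<ge> 3" and "p \<ge> 1"
    and "X \<subseteq> carrier_vec p" and "X \<noteq> {}"
    and "F \<in> admissible_cdfs"
  shows "card {\<sigma>. \<sigma> permutes {1..J} \<and> \<sigma> J = J} = fact (J - 1) \<and>
    (\<forall>\<sigma>. \<sigma> permutes {1..J} \<and> \<sigma> J = J \<longrightarrow>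
      invariant_model J X (reference_ratio J) F (complete_design J p) ((J - 1) * (1 + p)) \<sigma> \<and>
      invariant_model J X (reference_ratio J) F (proportional_design J p) (J - 1 + p) \<sigma>)"
proof -
  \<comment> \<open>This form yields both the count \<open>fact (J - 1)\<close> and the hypothesis
    of the two invariance lemmas.\<close>
  have fixing: "\<sigma> permutes {1..J} \<and> \<sigma> J = J \<longleftrightarrow> \<sigma> permutes {1..J - 1}" for \<sigma>
    using assms(1) by (intro fixing_last_permutes_iff) simp
  have "card {\<sigma>. \<sigma> permutes {1..J - 1}} = fact (J - 1)"
    by (rule card_permutations) auto
  then show ?thesis
    unfolding fixing
    using complete_invariant[OF assms(3)] proportional_invariant[OF assms(3)] by blast
qed

end
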